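(* Let $\boldsymbol f=(f_1,f_2):\mathbb R/L\mathbb Z\to\mathbb R^2$ be a smooth arc-length parametrized closed plane curve of length $L>0$ with rotation number $1$. Then $$I_{-1}\le \frac{I_0}{8\pi^2}.$$ Equality never holds except in the trivial case $\tilde\kappa\equiv 0$.
   Context: For an arc-length parametrized closed curve $\boldsymbol f=(f_1,f_2):\mathbb R/L\mathbb Z\to\mathbb R^2$ (so $\|\boldsymbol f'\|\equiv1$), let $\boldsymbol\nu=(-f_2',f_1')$, $\boldsymbol\kappa=\boldsymbol f''$, and let $\kappa=\boldsymbol\kappa\cdot\boldsymbol\nu$ be the curvature. The curve need not be simple or convex. Rotation number $1$ means $\int_0^L\kappa\,ds=2\pi$. The signed area is $A=-\frac12\int_0^L\boldsymbol f\cdot\boldsymbol\nu\,ds$. The deviation of curvature is $\tilde\kappa=\kappa-\frac1L\int_0^L\kappa\,ds=\kappa-\frac{2\pi}{L}$. Set $$I_{-1}=1-\frac{4\pi A}{L^2},\qquad I_0=L\int_0^L\tilde\kappa^2\,ds.$$ *)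

theory Defs
  imports "HOL-Analysis.Analysis"
begin

definition vderiv :: "(real \<Rightarrow> real ^ 2) \<Rightarrow> real \<Rightarrow> real ^ 2" where
  "vderiv f = (\<lambda>s. vector_derivative f (at s))"

definition smooth_curve :: "(real \<Rightarrow> real ^ 2) \<Rightarrow> bool" where
  "smooth_curve f \<longleftrightarrow> (\<forall>k s. (vderiv ^^ k) f differentiable (at s))"

text \<open>A map on the circle of length \<open>L\<close> is represented by its \<open>L\<close>-periodic lift to the real line.\<close>

definition arclength_closed_curve :: "real \<Rightarrow> (real \<Rightarrow> real ^ 2) \<Rightarrow> bool" where
  "arclength_closed_curve L f \<longleftrightarrow>
     L > 0 \<and> smooth_curve f \<and> (\<forall>s. f (s + L) = f s) \<and> (\<forall>s. norm (vderiv f s) = 1)"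

definition unit_normal :: "(real \<Rightarrow> real ^ 2) \<Rightarrow> real \<Rightarrow> real ^ 2" where
  "unit_normal f s = vector [- (vderiv f s $ 2), vderiv f s $ 1]"

definition curvature_vector :: "(real \<Rightarrow> real ^ 2) \<Rightarrow> real \<Rightarrow> real ^ 2" where
  "curvature_vector f = vderiv (vderiv f)"

definition curvature :: "(real \<Rightarrow> real ^ 2) \<Rightarrow> real \<Rightarrow> real" where
  "curvature f s = curvature_vector f s \<bullet> unit_normal f s"

definition rotation_number :: "real \<Rightarrow> (real \<Rightarrow> real ^ 2) \<Rightarrow> real" where
  "rotation_number L f = integral {0..L} (curvature f) / (2 * pi)"

definition signed_area :: "real \<Rightarrow> (real \<Rightarrow> real ^ 2) \<Rightarrow> real" where
  "signed_area L f = - (1 / 2) * integral {0..L} (\<lambda>s. f s \<bullet> unit_normal f s)"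

definition curvature_deviation :: "real \<Rightarrow> (real \<Rightarrow> real ^ 2) \<Rightarrow> real \<Rightarrow> real" where
  "curvature_deviation L f s = curvature f s - (1 / L) * integral {0..L} (curvature f)"

definition I_minus_one :: "real \<Rightarrow> (real \<Rightarrow> real ^ 2) \<Rightarrow> real" where
  "I_minus_one L f = 1 - 4 * pi * signed_area L f / L\<^sup>2"

definition I_zero :: "real \<Rightarrow> (real \<Rightarrow> real ^ 2) \<Rightarrow> real" where
  "I_zero L f = L * integral {0..L} (\<lambda>s. (curvature_deviation L f s)\<^sup>2)"

end

theory Submission
  imports Defs "HOL-Library.Nat_Bijection"
begin

text \<open>
  Read the curve as a complex function \<open>z\<close> with \<open>L\<close>-periodic derivatives and put
  \<open>\<omega> = 2 * pi / L\<close>. Unit speed gives \<open>z'' = \<i> * curvature * z'\<close>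
  (\<open>curvature_complex\<close>), and rotation number one says that the mean curvature is \<open>\<omega>\<close>.
  Therefore \<open>y = z'' - \<i> * \<omega> * z'\<close> equals \<open>\<i>\<close> times the curvature deviation times \<open>z'\<close>,
  so that \<open>y\<close> has the modulus of the deviation while being linear in \<open>z\<close>.
  With \<open>\<langle>u, v\<rangle>\<close> for the mean of \<open>u * cnj v\<close> over one period, \<open>I_zero = L\<^sup>2 * \<langle>y, y\<rangle>\<close>, and an
  integration by parts gives \<open>I_minus_one = - Re \<langle>z, y\<rangle>\<close>. Hence
  \<open>2 * \<omega>\<^sup>2 * (I_zero / (8 * pi\<^sup>2) - I_minus_one) = Re \<langle>y + 2 * \<omega>\<^sup>2 * z, y\<rangle>\<close>.

  If \<open>c n\<close> are the Fourier coefficients of \<open>z\<close>, Parseval's identity turns the right-hand side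
  into the sum over all integers \<open>n\<close> of \<open>\<omega>^4 * N * (N - 2) * \<bar>c n\<bar>\<^sup>2\<close> with \<open>N = n * (n - 1)\<close>.
  The values of \<open>N\<close> are \<open>0, 2, 6, 12, ...\<close>: none lies strictly between \<open>0\<close> and \<open>2\<close>, and so no
  term is negative (\<open>spectral_gap\<close>, \<open>defect_nonneg\<close>). This is the inequality.

  If equality holds, only the modes \<open>-1, 0, 1, 2\<close> occur in \<open>z\<close>, so only \<open>-1, 1, 2\<close> occur in
  \<open>z'\<close>. The nonzero differences of these three frequencies are pairwise distinct, so the
  cross terms in \<open>z' * cnj z' = 1\<close> cannot cancel each other and \<open>z'\<close> is a single mode \<open>m\<close>
  (\<open>unimodular_single_mode\<close>). Then \<open>y\<close> is the constant \<open>\<i> * \<omega> * (m - 1)\<close> times \<open>z'\<close>, so the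
  curvature deviation is constant; its mean is zero, hence it vanishes.

  The Fourier theory behind this is Parseval's identity for twice continuously
  differentiable functions. Completeness of the modes (\<open>fourier_eq_0_imp_0\<close>) comes from the
  Stone-Weierstrass theorem on the unit circle; two integrations by parts make the
  coefficients of such a function absolutely summable, so its Fourier series converges
  uniformly, and by completeness to the function itself.
\<close>

section \<open>Fourier modes and the mean inner product on an interval\<close>

definition mode :: "real \<Rightarrow> int \<Rightarrow> real \<Rightarrow> complex" where
  "mode L n s = cis (2 * pi * of_int n * s / L)"

definition pairing :: "real \<Rightarrow> (real \<Rightarrow> complex) \<Rightarrow> (real \<Rightarrow> complex) \<Rightarrow> complex" where
  "pairing L x y = integral {0..L} (\<lambda>s. x s * cnj (y s)) / of_real L"

definition fourier :: "real \<Rightarrow> (real \<Rightarrow> complex) \<Rightarrow> int \<Rightarrow> complex" where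
  "fourier L x n = pairing L x (mode L n)"

lemma mode_mult: "mode L m s * mode L n s = mode L (m + n) s"
  by (simp add: mode_def cis_mult add_divide_distrib distrib_left distrib_right)

lemma cnj_mode: "cnj (mode L n s) = mode L (- n) s"
  by (simp add: mode_def flip: cis_cnj)

lemma mode_zero [simp]: "mode L 0 s = 1"
  by (simp add: mode_def)

lemma norm_mode [simp]: "cmod (mode L n s) = 1"
  by (simp add: mode_def)

lemma mode_at_ends: "L > 0 \<Longrightarrow> mode L n L = mode L n 0"
  by (simp add: mode_def)

lemma mode_has_vector_derivative:
  "(mode L n has_vector_derivative \<i> * of_real (2 * pi / L * of_int n) * mode L n s) (at s)"
proof -
  define c where "c = 2 * pi / L * of_int n"
  have "((\<lambda>s. c * s) has_derivative (\<lambda>t. c * t)) (at s)"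
    by (auto intro!: derivative_eq_intros)
  from has_derivative_cis [OF this]
  have "((\<lambda>s. cis (c * s)) has_vector_derivative \<i> * of_real c * cis (c * s)) (at s)"
    by (simp add: has_vector_derivative_def scaleR_conv_of_real mult_ac)
  moreover have "mode L n = (\<lambda>s. cis (c * s))"
    by (simp add: mode_def c_def fun_eq_iff)
  ultimately show ?thesis
    by (simp add: c_def)
qed

lemma continuous_on_mode [continuous_intros]: "continuous_on A (mode L n)"
  by (meson continuous_at_imp_continuous_on has_vector_derivative_continuous
      mode_has_vector_derivative)

lemma pairing_add_left:
  assumes "continuous_on {0..L} x" "continuous_on {0..L} x'" "continuous_on {0..L} y"
  shows "pairing L (\<lambda>s. x s + x' s) y = pairing L x y + pairing L x' y"
proof -
  have "integral {0..L} (\<lambda>s. x s * cnj (y s) + x' s * cnj (y s))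
      = integral {0..L} (\<lambda>s. x s * cnj (y s)) + integral {0..L} (\<lambda>s. x' s * cnj (y s))"
    by (intro integral_add integrable_continuous_real continuous_intros assms)
  then show ?thesis
    by (simp add: pairing_def distrib_right add_divide_distrib)
qed

lemma pairing_scale_left: "pairing L (\<lambda>s. c * x s) y = c * pairing L x y"
  by (simp add: pairing_def mult.assoc)

lemma pairing_scale_right: "pairing L x (\<lambda>s. c * y s) = cnj c * pairing L x y"
proof -
  have "(\<lambda>s. x s * cnj (c * y s)) = (\<lambda>s. cnj c * (x s * cnj (y s)))"
    by (simp add: mult_ac)
  then show ?thesis by (simp add: pairing_def)
qed

lemma Re_Im_pairing:
  assumes "continuous_on {0..L} x" "continuous_on {0..L} y"
  shows "Re (pairing L x y) = integral {0..L} (\<lambda>s. Re (x s * cnj (y s))) / L"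
    and "Im (pairing L x y) = integral {0..L} (\<lambda>s. Im (x s * cnj (y s))) / L"
proof -
  have "(\<lambda>s. x s * cnj (y s)) integrable_on {0..L}"
    by (intro integrable_continuous_real continuous_intros assms)
  note int = integral_linear [OF this bounded_linear_Re] integral_linear [OF this bounded_linear_Im]
  show "Re (pairing L x y) = integral {0..L} (\<lambda>s. Re (x s * cnj (y s))) / L"
    "Im (pairing L x y) = integral {0..L} (\<lambda>s. Im (x s * cnj (y s))) / L"
    using int by (simp_all add: pairing_def o_def del: times_complex.sel)
qed

lemma norm_pairing_le:
  assumes "L > 0" "continuous_on {0..L} x" "continuous_on {0..L} y"
    and "\<And>s. s \<in> {0..L} \<Longrightarrow> cmod (x s) * cmod (y s) \<le> B"
  shows "cmod (pairing L x y) \<le> B"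
proof -
  have B: "0 \<le> B"
    using assms(1) by (intro order_trans [OF _ assms(4) [of 0]] mult_nonneg_nonneg) auto
  have "cmod (integral {0..L} (\<lambda>s. x s * cnj (y s))) \<le> B * measure lborel {0..L}"
  proof (rule has_integral_bound_real [OF B, of "{}"])
    show "((\<lambda>s. x s * cnj (y s)) has_integral integral {0..L} (\<lambda>s. x s * cnj (y s))) {0..L}"
      by (intro integrable_integral integrable_continuous_real continuous_intros assms)
  qed (use assms(4) in \<open>auto simp: norm_mult\<close>)
  then show ?thesis
    using assms(1) by (simp add: pairing_def norm_divide field_simps)
qed

lemma pairing_self_eq_0D:
  assumes "L > 0" "continuous_on {0..L} x" "pairing L x x = 0" "s \<in> {0..L}"
  shows "x s = 0"
proof -
  have eq: "(\<lambda>s. x s * cnj (x s)) = (\<lambda>s. of_real ((cmod (x s))\<^sup>2))"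
    by (simp add: complex_norm_square del: of_real_power)
  have int: "(\<lambda>s. (cmod (x s))\<^sup>2) integrable_on {0..L}"
    by (intro integrable_continuous_real continuous_intros assms)
  have "of_real (integral {0..L} (\<lambda>s. (cmod (x s))\<^sup>2))
      = integral {0..L} (\<lambda>s. complex_of_real ((cmod (x s))\<^sup>2))"
    using integral_linear [OF int bounded_linear_of_real [where 'a=complex]] by (simp add: o_def)
  also have "\<dots> = 0"
    using assms(1,3) by (simp add: pairing_def eq)
  finally have "integral {0..L} (\<lambda>s. (cmod (x s))\<^sup>2) = 0"
    by simp
  then have "((\<lambda>s. (cmod (x s))\<^sup>2) has_integral 0) (cbox 0 L)"
    using int by (metis box_real(2) integrable_integral)
  then have "(cmod (x s))\<^sup>2 = 0"
    by (rule has_integral_0_cbox_imp_0 [rotated 2])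
      (use assms in \<open>auto intro!: continuous_intros\<close>)
  then show ?thesis by simp
qed

text \<open>This is what allows a uniformly convergent series to be integrated term by term.\<close>

lemma pairing_tendsto:
  assumes "uniform_limit {0..L} X x sequentially"
    and "\<And>N::nat. continuous_on {0..L} (X N)" and y: "continuous_on {0..L} y"
  shows "(\<lambda>N. pairing L (X N) y) \<longlonglongrightarrow> pairing L x y"
proof -
  have x: "continuous_on {0..L} x"
    by (rule uniform_limit_theorem [OF _ assms(1)]) (use assms(2) in auto)
  have "uniform_limit {0..L} (\<lambda>N s. X N s * cnj (y s)) (\<lambda>s. x s * cnj (y s)) sequentially"
  proof (rule uniform_lim_mult [OF assms(1) uniform_limit_const])
    show "bounded (x ` {0..L})" "bounded ((\<lambda>s. cnj (y s)) ` {0..L})"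
      by (intro compact_imp_bounded compact_continuous_image continuous_intros x y; simp)+
  qed
  then obtain I J where IJ: "\<And>N. ((\<lambda>s. X N s * cnj (y s)) has_integral I N) {0..L}"
      "((\<lambda>s. x s * cnj (y s)) has_integral J) {0..L}" "I \<longlonglongrightarrow> J"
    by (rule uniform_limit_integral) (auto intro!: continuous_intros assms)
  then have "pairing L (X N) y = I N / of_real L" "pairing L x y = J / of_real L" for N
    by (auto simp: pairing_def integral_unique)
  then show ?thesis
    using tendsto_mult [OF IJ(3) tendsto_const [of "inverse (of_real L)"]]
    by (simp add: divide_inverse)
qed

lemma pairing_by_parts:
  assumes "L > 0"
    and x: "\<And>s. (x has_vector_derivative x' s) (at s)" "continuous_on {0..L} x'" "x L = x 0"
    and y: "\<And>s. (y has_vector_derivative y' s) (at s)" "continuous_on {0..L} y'" "y L = y 0"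
  shows "pairing L x' y = - pairing L x y'"
proof -
  have cont: "continuous_on {0..L} x" "continuous_on {0..L} y"
    by (meson continuous_at_imp_continuous_on has_vector_derivative_continuous x(1) y(1))+
  have cy: "((\<lambda>s. cnj (y s)) has_vector_derivative cnj (y' s)) (at s)" for s
    using bounded_linear.has_vector_derivative [OF bounded_linear_cnj y(1)] .
  have "((\<lambda>s. x s * cnj (y' s) + x' s * cnj (y s)) has_integral
      (x L * cnj (y L) - x 0 * cnj (y 0))) {0..L}"
    by (rule fundamental_theorem_of_calculus)
      (use \<open>L > 0\<close> in \<open>auto intro: has_vector_derivative_at_within
        has_vector_derivative_mult [OF x(1) cy]\<close>)
  then have "integral {0..L} (\<lambda>s. x s * cnj (y' s) + x' s * cnj (y s)) = 0"
    by (simp add: x y integral_unique)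
  also have "integral {0..L} (\<lambda>s. x s * cnj (y' s) + x' s * cnj (y s)) =
      integral {0..L} (\<lambda>s. x s * cnj (y' s)) + integral {0..L} (\<lambda>s. x' s * cnj (y s))"
    by (intro integral_add integrable_continuous_real continuous_intros x y cont)
  finally show ?thesis
    by (simp add: pairing_def eq_neg_iff_add_eq_0 add.commute flip: add_divide_distrib)
qed

lemma pairing_mode_left:
  "pairing L (\<lambda>s. x s * mode L m s) y = pairing L x (\<lambda>s. mode L (- m) s * y s)"
  by (simp add: pairing_def cnj_mode mult_ac)

lemma fourier_times_mode: "fourier L (\<lambda>s. x s * mode L m s) n = fourier L x (n - m)"
  by (simp add: fourier_def pairing_mode_left mode_mult)

text \<open>Integration by parts moves the derivative onto the mode. The boundary terms cancel
  because \<open>x\<close> and the mode both close up at the ends of the interval.\<close>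

lemma fourier_deriv:
  assumes "L > 0"
    and "\<And>s. (x has_vector_derivative x' s) (at s)" "continuous_on {0..L} x'" "x L = x 0"
  shows "fourier L x' n = \<i> * of_real (2 * pi / L * of_int n) * fourier L x n"
proof -
  have "fourier L x' n = - pairing L x (\<lambda>s. \<i> * of_real (2 * pi / L * of_int n) * mode L n s)"
    unfolding fourier_def
    by (rule pairing_by_parts [OF assms mode_has_vector_derivative _ mode_at_ends [OF assms(1)]])
      (use assms(1) in \<open>auto intro!: continuous_intros\<close>)
  then show ?thesis
    by (simp only: pairing_scale_right fourier_def) simp
qed

text \<open>Multiplying by a mode shifts the frequency, so orthonormality reduces to the constant
  function, whose derivative \<open>0\<close> forces all coefficients but the one at \<open>0\<close> to vanish.\<close>

lemma fourier_mode:
  assumes "L > 0"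
  shows "fourier L (mode L m) n = (if m = n then 1 else 0)"
proof -
  have one: "fourier L (\<lambda>s. 1) k = (if k = 0 then 1 else 0)" for k
  proof (cases "k = 0")
    case True
    then show ?thesis
      using assms by (simp add: fourier_def pairing_def cnj_mode scaleR_conv_of_real)
  next
    case False
    have "fourier L (\<lambda>s. 0) k = \<i> * of_real (2 * pi / L * of_int k) * fourier L (\<lambda>s. 1) k"
      by (rule fourier_deriv) (use assms in auto)
    moreover have "fourier L (\<lambda>s. 0) k = 0"
      by (simp add: fourier_def pairing_def)
    ultimately show ?thesis
      using False assms by auto
  qed
  show ?thesis
    using fourier_times_mode [of L "\<lambda>s. 1" m n] one [of "n - m"] by auto
qed

lemma fourier_add:
  assumes "continuous_on {0..L} x" "continuous_on {0..L} y"
  shows "fourier L (\<lambda>s. x s + y s) n = fourier L x n + fourier L y n"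
  by (simp add: fourier_def pairing_add_left assms continuous_on_mode)

lemma fourier_scale: "fourier L (\<lambda>s. c * x s) n = c * fourier L x n"
  by (simp add: fourier_def pairing_scale_left)

section \<open>Completeness of the modes\<close>

text \<open>The functions with vanishing coefficients are closed under multiplication by modes, hence
  under multiplication by the real and imaginary parts of \<open>mode L 1\<close>. The function \<open>d\<close> has to
  vary in the induction: for a product of two polynomials, the hypothesis on the second factor is
  applied to \<open>d\<close> already multiplied by the first.\<close>

lemma fourier_polynomial_of_mode:
  assumes "real_polynomial_function (g :: complex \<Rightarrow> real)"
    and "continuous_on {0..L} d" "\<And>n. fourier L d n = 0"
  shows "continuous_on {0..L} (\<lambda>s. d s * of_real (g (mode L 1 s))) \<and>
    (\<forall>n. fourier L (\<lambda>s. d s * of_real (g (mode L 1 s))) n = 0)"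
  using assms
proof (induction arbitrary: d)
  case (linear g)
  define a where "a = (of_real (g 1) - \<i> * of_real (g \<i>)) / 2"
  \<comment> \<open>A real-linear form on the plane is \<open>w \<mapsto> 2 * Re (a * w)\<close>.\<close>
  have g: "of_real (g w) = a * w + cnj a * cnj w" for w
  proof -
    have "g w = g (Re w *\<^sub>R 1 + Im w *\<^sub>R \<i>)"
      by (simp add: scaleR_conv_of_real complex_eq mult.commute flip: complex_eq)
    also have "\<dots> = Re w * g 1 + Im w * g \<i>"
      using linear.hyps by (simp only: linear_add linear_scale bounded_linear.linear) simp
    finally show ?thesis
      by (simp add: a_def complex_eq_iff field_simps)
  qed
  have "d s * of_real (g (mode L 1 s)) = a * (d s * mode L 1 s) + cnj a * (d s * mode L (- 1) s)"
    for s by (simp add: g cnj_mode algebra_simps)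
  then show ?case
    by (simp add: fourier_add fourier_scale fourier_times_mode linear.prems
        continuous_on_add continuous_on_mult continuous_on_const continuous_on_mode)
next
  case (const c)
  then show ?case
    using fourier_scale [of L "of_real c" d] by (auto intro!: continuous_intros simp: mult.commute)
next
  case (add f g)
  show ?case
    using add.IH(1) [OF add.prems] add.IH(2) [OF add.prems]
    by (simp add: distrib_left fourier_add continuous_on_add)
next
  case (mult f g)
  show ?case
    using mult.IH(2) [of "\<lambda>s. d s * of_real (f (mode L 1 s))"] mult.IH(1) [OF mult.prems]
    by (simp add: mult.assoc)
qed

text \<open>The circle is the interval with its ends glued, and \<open>Arg2pi\<close> chooses the preimage. \<open>Arg2pi\<close>
  jumps at \<open>1\<close>, so continuity of the induced function comes from compactness instead: preimages of
  closed sets are images of compact subsets of the interval.\<close>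

lemma periodic_function_on_circle:
  fixes d :: "real \<Rightarrow> complex"
  assumes "L > 0" and d: "continuous_on {0..L} d" "d L = d 0"
  obtains F where "continuous_on (sphere 0 1) F" "\<And>s. s \<in> {0..L} \<Longrightarrow> F (mode L 1 s) = d s"
proof
  define F where "F w = d (L * Arg2pi w / (2 * pi))" for w
  show F: "F (mode L 1 s) = d s" if "s \<in> {0..L}" for s
  proof (cases "s = L")
    case True
    have "mode L 1 L = of_real 1"
      using assms(1) by (simp add: mode_def)
    then have "Arg2pi (mode L 1 L) = 0"
      by (simp add: Arg2pi_unique [of 1])
    then show ?thesis
      using True d by (simp add: F_def)
  next
    case False
    then have "Arg2pi (mode L 1 s) = 2 * pi * s / L"
      using that assms(1)
      by (intro Arg2pi_unique [of 1]) (auto simp: mode_def cis_conv_exp field_simps)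
    then show ?thesis
      using assms(1) by (simp add: F_def)
  qed
  have onto: "\<exists>s\<in>{0..L}. w = mode L 1 s" if "w \<in> sphere 0 1" for w
  proof
    show "L * Arg2pi w / (2 * pi) \<in> {0..L}"
      using assms(1) Arg2pi_ge_0 [of w] Arg2pi_lt_2pi [of w] by (simp add: field_simps)
    show "w = mode L 1 (L * Arg2pi w / (2 * pi))"
      using assms(1) that Arg2pi_eq [of w] by (simp add: mode_def cis_conv_exp)
  qed
  show "continuous_on (sphere 0 1) F"
  proof (subst continuous_on_closed_vimage)
    show "\<forall>B. closed B \<longrightarrow> closed (F -` B \<inter> sphere 0 1)"
    proof (intro allI impI)
      fix B :: "complex set" assume B: "closed B"
      have "F -` B \<inter> sphere 0 1 = mode L 1 ` ({0..L} \<inter> d -` B)"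
      proof (intro equalityI subsetI)
        fix w assume w: "w \<in> F -` B \<inter> sphere 0 1"
        then obtain s where "s \<in> {0..L}" "w = mode L 1 s"
          using onto by blast
        then show "w \<in> mode L 1 ` ({0..L} \<inter> d -` B)"
          using w F by auto
      qed (use F in auto)
      moreover have "compact ({0..L} \<inter> d -` B)"
        using continuous_closed_preimage [OF d(1) _ B] compact_Icc
        by (metis Int_absorb Int_assoc closed_atLeastAtMost compact_Int_closed)
      ultimately show "closed (F -` B \<inter> sphere 0 1)"
        by (metis compact_continuous_image compact_imp_closed continuous_on_mode)
    qed
  qed simp
qed

text \<open>By Stone-Weierstrass, \<open>d\<close> is uniformly close to a polynomial \<open>h\<close> in the first mode. All such
  polynomials are orthogonal to \<open>d\<close>, so \<open>pairing L d d = pairing L d (d - h)\<close> is arbitrarily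
  small.\<close>

lemma fourier_eq_0_imp_0:
  assumes L: "L > 0" and d: "continuous_on {0..L} d" "d L = d 0"
    and zero: "\<And>n. fourier L d n = 0" and s: "s \<in> {0..L}"
  shows "d s = 0"
proof -
  obtain F where F: "continuous_on (sphere 0 1) F"
      "\<And>s. s \<in> {0..L} \<Longrightarrow> F (mode L 1 s) = d s"
    using periodic_function_on_circle [OF L d] by blast
  have "bounded (d ` {0..L})"
    by (intro compact_imp_bounded compact_continuous_image d) simp
  then obtain M where M: "M > 0" "\<And>s. s \<in> {0..L} \<Longrightarrow> cmod (d s) \<le> M"
    unfolding bounded_pos by auto
  have small: "cmod (pairing L d d) \<le> M * e" if "e > 0" for e
  proof -
    obtain g where g: "polynomial_function g"
        "\<And>w. w \<in> sphere 0 1 \<Longrightarrow> cmod (F w - g w) < e"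
      using Stone_Weierstrass_polynomial_function [OF _ F(1) \<open>e > 0\<close>] by auto
    define h where "h s = g (mode L 1 s)" for s
    have h: "continuous_on {0..L} h"
      unfolding h_def
      using continuous_on_polymonial_function [OF g(1)] continuous_on_mode
      by (rule continuous_on_compose2) auto
    have "real_polynomial_function (\<lambda>w. Re (g w))" "real_polynomial_function (\<lambda>w. Im (g w))"
      using g(1) bounded_linear_Re bounded_linear_Im by (auto simp: polynomial_function_def o_def)
    note P = this [THEN fourier_polynomial_of_mode, OF d(1) zero]
    have "d s * cnj (h s) = d s * of_real (Re (g (mode L 1 s)))
        + (- \<i>) * (d s * of_real (Im (g (mode L 1 s))))" for s
      by (simp add: h_def complex_eq_iff algebra_simps)
    then have "fourier L (\<lambda>s. d s * cnj (h s)) 0 = 0"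
      using P by (auto simp only: fourier_add fourier_scale continuous_intros) simp
    then have "pairing L d h = 0"
      by (simp add: fourier_def pairing_def)
    moreover have "pairing L d (\<lambda>s. d s - h s) = pairing L d d - pairing L d h"
    proof -
      have "integral {0..L} (\<lambda>s. d s * cnj (d s) - d s * cnj (h s))
          = integral {0..L} (\<lambda>s. d s * cnj (d s)) - integral {0..L} (\<lambda>s. d s * cnj (h s))"
        by (intro integral_diff integrable_continuous_real continuous_intros d h)
      then show ?thesis
        by (simp add: pairing_def right_diff_distrib diff_divide_distrib)
    qed
    moreover have "cmod (pairing L d (\<lambda>s. d s - h s)) \<le> M * e"
    proof (rule norm_pairing_le [OF L d(1)])
      show "continuous_on {0..L} (\<lambda>s. d s - h s)"
        by (intro continuous_intros d h)
      show "cmod (d s) * cmod (d s - h s) \<le> M * e" if "s \<in> {0..L}" for s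
        using M(2) [OF that] M(1) F(2) [OF that] g(2) [of "mode L 1 s"]
        by (intro mult_mono) (auto simp: h_def)
    qed
    ultimately show ?thesis by simp
  qed
  have "cmod (pairing L d d) \<le> 0"
  proof (rule field_le_epsilon)
    fix e :: real assume "e > 0"
    then show "cmod (pairing L d d) \<le> 0 + e"
      using small [of "e / M"] M(1) by simp
  qed
  then show ?thesis
    using pairing_self_eq_0D [OF L d(1) _ s] by simp
qed

section \<open>Uniform convergence and Parseval's identity\<close>

text \<open>Series over the integers are summed along the enumeration \<open>int_decode\<close>; this bound makes
  quadratic decay in the frequency quadratic decay in the index.\<close>

lemma abs_int_decode: "real k \<le> 2 * \<bar>real_of_int (int_decode k)\<bar>"
  by (auto simp: int_decode_def sum_decode_def real_of_nat_div elim!: evenE oddE)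

text \<open>The coefficients of \<open>p''\<close> are bounded and are, up to a constant factor, those of \<open>p\<close> times the
  squared frequency, so the series converges uniformly by the Weierstrass test. Its sum has the same coefficients as \<open>p\<close>, and
  completeness identifies the two.\<close>

lemma fourier_series_uniform:
  assumes L: "L > 0"
    and p: "\<And>s. (p has_vector_derivative p' s) (at s)" "p L = p 0"
    and p': "\<And>s. (p' has_vector_derivative p'' s) (at s)" "p' L = p' 0"
    and p'': "continuous_on {0..L} p''"
  shows "uniform_limit {0..L}
    (\<lambda>N s. \<Sum>k<N. fourier L p (int_decode k) * mode L (int_decode k) s) p sequentially"
proof -
  have cont: "continuous_on {0..L} p" "continuous_on {0..L} p'"
    by (meson continuous_at_imp_continuous_on has_vector_derivative_continuous p(1) p'(1))+
  have "bounded (p'' ` {0..L})"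
    by (intro compact_imp_bounded compact_continuous_image p'') simp
  then obtain B where B: "B > 0" "\<And>s. s \<in> {0..L} \<Longrightarrow> cmod (p'' s) \<le> B"
    unfolding bounded_pos by auto
  define D where "D = B * L\<^sup>2 / pi\<^sup>2"
  have decay: "cmod (fourier L p (int_decode k)) \<le> D * (1 / real k ^ 2)" if "k \<noteq> 0" for k
  proof -
    define r where "r = real_of_int (int_decode k)"
    have "fourier L p'' (int_decode k)
        = - of_real ((2 * pi / L * r)\<^sup>2) * fourier L p (int_decode k)"
      unfolding fourier_deriv [OF L p'(1) p'' p'(2)] fourier_deriv [OF L p(1) cont(2) p(2)] r_def
      by (simp add: power2_eq_square algebra_simps)
    moreover have "cmod (fourier L p'' (int_decode k)) \<le> B"
      unfolding fourier_def by (rule norm_pairing_le [OF L p'' continuous_on_mode]) (use B in simp)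
    ultimately have "(2 * pi / L * r)\<^sup>2 * cmod (fourier L p (int_decode k)) \<le> B"
      by (simp add: norm_mult norm_power norm_divide power_divide power_mult_distrib)
    moreover have "(pi / L)\<^sup>2 * (real k)\<^sup>2 \<le> (2 * pi / L * r)\<^sup>2"
    proof -
      have "(real k)\<^sup>2 \<le> (2 * \<bar>r\<bar>)\<^sup>2"
        using abs_int_decode [of k] by (intro power_mono) (auto simp: r_def)
      then have "(pi / L)\<^sup>2 * (real k)\<^sup>2 \<le> (pi / L)\<^sup>2 * (2 * \<bar>r\<bar>)\<^sup>2"
        by (intro mult_left_mono) auto
      then show ?thesis by (simp add: power_mult_distrib power_divide mult_ac)
    qed
    ultimately have "(pi / L)\<^sup>2 * (real k)\<^sup>2 * cmod (fourier L p (int_decode k)) \<le> B"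
      by (meson mult_right_mono norm_ge_zero order_trans)
    then show ?thesis
      using L that by (simp add: D_def field_simps)
  qed
  let ?F = "\<lambda>s. \<Sum>k. fourier L p (int_decode k) * mode L (int_decode k) s"
  have lim: "uniform_limit {0..L}
    (\<lambda>N s. \<Sum>k<N. fourier L p (int_decode k) * mode L (int_decode k) s) ?F sequentially"
  proof (rule Weierstrass_m_test_ev)
    show "summable (\<lambda>k. D * (1 / real k ^ 2))"
      by (intro summable_mult) (use inverse_power_summable [of 2, where 'a=real] in \<open>simp add: inverse_eq_divide\<close>)
    show "\<forall>\<^sub>F k in sequentially. \<forall>s\<in>{0..L}.
        cmod (fourier L p (int_decode k) * mode L (int_decode k) s) \<le> D * (1 / real k ^ 2)"
      using eventually_gt_at_top [of 0] by eventually_elim (use decay in \<open>simp add: norm_mult\<close>)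
  qed
  have cont_sum: "continuous_on {0..L}
      (\<lambda>s. \<Sum>k<N. fourier L p (int_decode k) * mode L (int_decode k) s)" for N
    by (intro continuous_intros)
  have F: "continuous_on {0..L} ?F"
    by (rule uniform_limit_theorem [OF _ lim]) (use cont_sum in auto)
  have coeff: "fourier L ?F n = fourier L p n" for n
  proof -
    have "fourier L (\<lambda>s. \<Sum>k<N. fourier L p (int_decode k) * mode L (int_decode k) s) n
        = (\<Sum>k<N. if int_decode k = n then fourier L p n else 0)" for N
    proof (induction N)
      case 0
      then show ?case by (simp add: fourier_def pairing_def)
    next
      case (Suc N)
      then show ?case
        using L by (simp add: fourier_add cont_sum continuous_intros fourier_scale fourier_mode)
    qed
    also have "(\<Sum>k<N. if int_decode k = n then fourier L p n else 0)
        = (if int_encode n < N then fourier L p n else 0)" for N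
    proof -
      have "int_decode k = n \<longleftrightarrow> k = int_encode n" for k by auto
      then show ?thesis by simp
    qed
    finally have "(\<lambda>N. if int_encode n < N then fourier L p n else 0) \<longlonglongrightarrow> fourier L ?F n"
      using pairing_tendsto [OF lim cont_sum continuous_on_mode, of L n] by (simp add: fourier_def)
    moreover have "(\<lambda>N. if int_encode n < N then fourier L p n else 0) \<longlonglongrightarrow> fourier L p n"
      by (rule tendsto_eventually)
        (use eventually_gt_at_top [of "int_encode n"] in eventually_elim, simp)
    ultimately show ?thesis
      by (rule LIMSEQ_unique)
  qed
  have "?F s = p s" if "s \<in> {0..L}" for s
  proof -
    have "p s + (- 1) * ?F s = 0"
    proof (rule fourier_eq_0_imp_0 [OF L _ _ _ that])
      show "continuous_on {0..L} (\<lambda>s. p s + (- 1) * ?F s)"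
        by (intro continuous_on_add continuous_on_mult continuous_on_const cont F)
      show "p L + (- 1) * ?F L = p 0 + (- 1) * ?F 0"
        using mode_at_ends [OF L] p by simp
      show "fourier L (\<lambda>s. p s + (- 1) * ?F s) n = 0" for n
      proof -
        have "fourier L (\<lambda>s. p s + (- 1) * ?F s) n
            = fourier L p n + fourier L (\<lambda>s. (- 1) * ?F s) n"
          by (intro fourier_add cont continuous_on_mult continuous_on_const F)
        also have "\<dots> = 0"
          by (simp only: fourier_scale coeff) simp
        finally show ?thesis .
      qed
    qed
    then show ?thesis by simp
  qed
  then show ?thesis
    by (intro uniform_limit_cong' [THEN iffD1, OF _ _ lim]) auto
qed

lemma cnj_pairing: "cnj (pairing L x y) = pairing L y x"
  by (simp add: pairing_def integral_cnj mult.commute)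

lemma parseval:
  assumes L: "L > 0"
    and p: "\<And>s. (p has_vector_derivative p' s) (at s)" "p L = p 0"
    and p': "\<And>s. (p' has_vector_derivative p'' s) (at s)" "p' L = p' 0"
    and p'': "continuous_on {0..L} p''"
    and y: "continuous_on {0..L} y"
  shows "(\<lambda>k. fourier L p (int_decode k) * cnj (fourier L y (int_decode k))) sums pairing L p y"
proof -
  have cont_sum: "continuous_on {0..L}
      (\<lambda>s. \<Sum>k<N. fourier L p (int_decode k) * mode L (int_decode k) s)" for N
    by (intro continuous_intros)
  have "pairing L (\<lambda>s. \<Sum>k<N. fourier L p (int_decode k) * mode L (int_decode k) s) y
      = (\<Sum>k<N. fourier L p (int_decode k) * cnj (fourier L y (int_decode k)))" for N
  proof (induction N)
    case 0
    then show ?case by (simp add: pairing_def)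
  next
    case (Suc N)
    then show ?case
      by (simp add: pairing_add_left cont_sum continuous_intros y pairing_scale_left
          fourier_def cnj_pairing)
  qed
  then show ?thesis
    using pairing_tendsto [OF fourier_series_uniform [OF L p p' p''] cont_sum y]
    by (simp add: sums_def)
qed


text \<open>With only finitely many nonzero coefficients, continuity suffices: the difference of both
  sides has no coefficients at all.\<close>

lemma finite_fourier_series:
  assumes L: "L > 0" and x: "continuous_on {0..L} x" "x L = x 0"
    and S: "finite S" "\<And>n. n \<notin> S \<Longrightarrow> fourier L x n = 0" and s: "s \<in> {0..L}"
  shows "x s = (\<Sum>n\<in>S. fourier L x n * mode L n s)"
proof -
  define T where "T s = (\<Sum>n\<in>S. fourier L x n * mode L n s)" for s
  have T: "continuous_on {0..L} T"
    unfolding T_def by (intro continuous_intros)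
  have sum: "fourier L (\<lambda>s. \<Sum>m\<in>R. fourier L x m * mode L m s) n
      = (\<Sum>m\<in>R. if m = n then fourier L x m else 0)" if "finite R" for R n
    using that
  proof (induction R)
    case empty
    then show ?case by (simp add: fourier_def pairing_def)
  next
    case (insert m R)
    then show ?case
      using L by (auto simp: fourier_add fourier_scale fourier_mode continuous_intros)
  qed
  have "x s + (- 1) * T s = 0"
  proof (rule fourier_eq_0_imp_0 [OF L _ _ _ s])
    show "continuous_on {0..L} (\<lambda>s. x s + (- 1) * T s)"
      by (intro continuous_intros x T)
    show "x L + (- 1) * T L = x 0 + (- 1) * T 0"
      using mode_at_ends [OF L] x by (simp add: T_def)
    show "fourier L (\<lambda>s. x s + (- 1) * T s) n = 0" for n
    proof -
      have "fourier L (\<lambda>s. x s + (- 1) * T s) n = fourier L x n + fourier L (\<lambda>s. (- 1) * T s) n"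
        by (intro fourier_add x continuous_intros T)
      also have "\<dots> = fourier L x n - fourier L T n"
        by (simp only: fourier_scale) simp
      also have "fourier L T n = fourier L x n"
        using S unfolding T_def by (simp add: sum)
      finally show ?thesis by simp
    qed
  qed
  then show ?thesis by (simp add: T_def)
qed

section \<open>Unimodular functions with sparse spectrum\<close>

text \<open>The differences of two distinct elements of \<open>{-1, 1, 2}\<close> are \<open>1, 2, 3\<close> up to sign, and each
  arises from one pair only. So the coefficient of \<open>x * cnj x = 1\<close> at each of \<open>1, 2, 3\<close> is a single
  product of two coefficients of \<open>x\<close>, which must vanish.\<close>

lemma unimodular_single_mode:
  assumes L: "L > 0" and x: "continuous_on {0..L} x" "x L = x 0"
    and supp: "\<And>n. n \<notin> {-1, 1, 2} \<Longrightarrow> fourier L x n = 0"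
    and unit: "\<And>s. s \<in> {0..L} \<Longrightarrow> cmod (x s) = 1"
  obtains m where "\<And>n. n \<noteq> m \<Longrightarrow> fourier L x n = 0"
proof -
  define a b c where "a = fourier L x (- 1)" and "b = fourier L x 1" and "c = fourier L x 2"
  define X where "X s = a * mode L (- 1) s + b * mode L 1 s + c * mode L 2 s" for s
  define e where "e n = (if n = 0 then 1 else 0 :: complex)" for n :: int
  have coeff: "fourier L (\<lambda>s. X s * cnj (X s)) n = e n" for n
  proof -
    have "X s * cnj (X s) = 1" if "s \<in> {0..L}" for s
    proof -
      have "x s = X s"
        using finite_fourier_series [OF L x, of "{-1, 1, 2}" s] supp that
        by (simp add: X_def a_def b_def c_def add_ac)
      then show ?thesis
        using unit [OF that] by (metis complex_norm_square of_real_1 one_power2)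
    qed
    then have "fourier L (\<lambda>s. X s * cnj (X s)) n = fourier L (mode L 0) n"
      unfolding fourier_def pairing_def
      by (intro arg_cong2 [where f = "(/)"] refl integral_cong) simp
    then show ?thesis
      using L by (simp add: fourier_mode e_def)
  qed
  have fourier_mode': "fourier L (mode L m) n = e (n - m)" for m n
    using L by (simp add: fourier_mode e_def)
  have "X s * cnj (X s) = (a * cnj a + b * cnj b + c * cnj c) * mode L 0 s
      + (b * cnj a) * mode L 2 s + (a * cnj b) * mode L (- 2) s
      + (c * cnj a) * mode L 3 s + (a * cnj c) * mode L (- 3) s
      + (c * cnj b) * mode L 1 s + (b * cnj c) * mode L (- 1) s" for s
    by (simp add: X_def cnj_mode distrib_left distrib_right mult_ac mode_mult
        mult.left_commute [of "mode L _ s" _ "mode L _ s"])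
  then have "fourier L (\<lambda>s. X s * cnj (X s)) n = (a * cnj a + b * cnj b + c * cnj c) * e n
      + (b * cnj a) * e (n - 2) + (a * cnj b) * e (n + 2)
      + (c * cnj a) * e (n - 3) + (a * cnj c) * e (n + 3)
      + (c * cnj b) * e (n - 1) + (b * cnj c) * e (n + 1)" for n
    using fourier_mode' by (simp add: fourier_add fourier_scale continuous_on_mode
        continuous_on_add continuous_on_mult continuous_on_const del: mode_zero)
  from this [of 1] this [of 2] this [of 3]
  have "c = 0 \<or> b = 0" "b = 0 \<or> a = 0" "c = 0 \<or> a = 0"
    unfolding coeff by (auto simp: e_def)
  then consider "b = 0" "c = 0" | "a = 0" "c = 0" | "a = 0" "b = 0"
    by auto
  then show ?thesis
  proof cases
    case 1
    have "fourier L x n = 0" if "n \<noteq> - 1" for n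
      using that supp [of n] 1 by (cases "n \<in> {-1, 1, 2}") (auto simp: b_def c_def)
    then show ?thesis by (rule that)
  next
    case 2
    have "fourier L x n = 0" if "n \<noteq> 1" for n
      using that supp [of n] 2 by (cases "n \<in> {-1, 1, 2}") (auto simp: a_def c_def)
    then show ?thesis by (rule that)
  next
    case 3
    have "fourier L x n = 0" if "n \<noteq> 2" for n
      using that supp [of n] 3 by (cases "n \<in> {-1, 1, 2}") (auto simp: a_def b_def)
    then show ?thesis by (rule that)
  qed
qed

section \<open>The spectral form of the defect\<close>

text \<open>The product factors as \<open>(n + 1) * n * (n - 1) * (n - 2)\<close>, with four consecutive integers as
  roots. Over the reals it is negative between \<open>-1\<close> and \<open>0\<close> and between \<open>1\<close> and \<open>2\<close>, so
  integrality is essential here.\<close>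

lemma spectral_gap:
  fixes n :: int
  shows "0 \<le> n * (n - 1) * (n * (n - 1) - 2)"
    and "n * (n - 1) * (n * (n - 1) - 2) = 0 \<Longrightarrow> n \<in> {-1, 0, 1, 2}"
proof -
  have fac: "n * (n - 1) - 2 = (n + 1) * (n - 2)"
    by (simp add: algebra_simps)
  have "0 \<le> n * (n - 1)"
    by (cases "n \<le> 0") (auto intro: mult_nonneg_nonneg mult_nonpos_nonpos)
  moreover have "0 \<le> (n + 1) * (n - 2)" if "n \<noteq> 0" "n \<noteq> 1"
    using that by (cases "n < 0") (auto intro: mult_nonneg_nonneg mult_nonpos_nonpos)
  ultimately show "0 \<le> n * (n - 1) * (n * (n - 1) - 2)"
    unfolding fac by (cases "n = 0 \<or> n = 1") auto
  show "n \<in> {-1, 0, 1, 2}" if "n * (n - 1) * (n * (n - 1) - 2) = 0"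
    using that unfolding fac by auto
qed

text \<open>For a function with derivatives \<open>Z 1, Z 2, ...\<close>, the pairing has the Fourier expansion
  with the nonnegative weights of \<open>spectral_gap\<close>; it can only vanish if every mode with a positive
  weight is absent. Parseval needs two derivatives of \<open>p\<close>, so four of \<open>Z 0\<close> are used.\<close>

lemma defect_nonneg:
  fixes Z :: "nat \<Rightarrow> real \<Rightarrow> complex"
  assumes L: "L > 0"
    and Z: "\<And>k s. (Z k has_vector_derivative Z (Suc k) s) (at s)" "\<And>k. Z k L = Z k 0"
  defines "\<omega> \<equiv> 2 * pi / L"
  defines "y \<equiv> \<lambda>s. Z 2 s - \<i> * of_real \<omega> * Z 1 s"
  defines "p \<equiv> \<lambda>s. y s + 2 * (of_real \<omega>)\<^sup>2 * Z 0 s"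
  shows "0 \<le> Re (pairing L p y)"
    and "Re (pairing L p y) = 0 \<Longrightarrow> n \<notin> {-1, 0, 1, 2} \<Longrightarrow> fourier L (Z 0) n = 0"
proof -
  have \<omega>: "\<omega> > 0"
    using L by (simp add: \<omega>_def)
  have cont [continuous_intros]: "continuous_on {0..L} (Z k)" for k
    by (meson continuous_at_imp_continuous_on has_vector_derivative_continuous Z(1))
  define c where "c = fourier L (Z 0)"
  define q where "q n = n * (n - 1) * (n * (n - 1) - 2)" for n :: int
  have step: "fourier L (Z (Suc k)) n = \<i> * of_real (\<omega> * of_int n) * fourier L (Z k) n" for k n
    unfolding \<omega>_def by (rule fourier_deriv [OF L Z(1) cont Z(2)])
  have Z2: "fourier L (Z 2) n = - (of_real \<omega> * of_int n)\<^sup>2 * c n" for n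
    using step [of 1 n] step [of 0 n]
    by (simp add: c_def numeral_2_eq_2 power2_eq_square algebra_simps)
  have Z1: "fourier L (Z 1) n = \<i> * of_real \<omega> * of_int n * c n" for n
    using step [of 0 n] by (simp add: c_def)
  have y_cont: "continuous_on {0..L} y"
    unfolding y_def by (intro continuous_intros)
  have y: "fourier L y n = - ((of_real \<omega>)\<^sup>2 * of_int (n * (n - 1))) * c n" for n
  proof -
    have "fourier L y n = fourier L (\<lambda>s. Z 2 s + (- \<i> * of_real \<omega>) * Z 1 s) n"
      by (simp add: y_def)
    also have "\<dots> = fourier L (Z 2) n + (- \<i> * of_real \<omega>) * fourier L (Z 1) n"
      by (subst fourier_add) (intro continuous_intros | simp only: fourier_scale)+
    finally show ?thesis
      unfolding Z1 Z2 by (simp add: power2_eq_square algebra_simps)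
  qed
  have p: "fourier L p n = - ((of_real \<omega>)\<^sup>2 * of_int (n * (n - 1) - 2)) * c n" for n
  proof -
    have "fourier L p n = fourier L y n + 2 * (of_real \<omega>)\<^sup>2 * c n"
      unfolding p_def c_def
      by (subst fourier_add) (intro continuous_intros y_cont | simp only: fourier_scale)+
    then show ?thesis
      by (simp add: y algebra_simps)
  qed
  have product: "fourier L p n * cnj (fourier L y n)
      = of_real (\<omega> ^ 4 * of_int (q n) * (cmod (c n))\<^sup>2)" for n
  proof -
    have "fourier L p n * cnj (fourier L y n)
        = (of_real \<omega>) ^ 4 * of_int (q n) * (c n * cnj (c n))"
      by (simp add: p y q_def algebra_simps power2_eq_square power4_eq_xxxx)
    then show ?thesis
      by (simp flip: complex_norm_square)
  qed
  define u where "u k = \<omega> ^ 4 * of_int (q (int_decode k)) * (cmod (c (int_decode k)))\<^sup>2" for k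
  have u_nonneg: "0 \<le> u k" for k
    using spectral_gap(1) [of "int_decode k"] by (simp add: u_def q_def del: of_int_mult)
  have "(\<lambda>k. fourier L p (int_decode k) * cnj (fourier L y (int_decode k))) sums pairing L p y"
  proof (rule parseval [OF L _ _ _ _ _ y_cont])
    define p' where "p' s = Z 3 s - \<i> * of_real \<omega> * Z 2 s + 2 * (of_real \<omega>)\<^sup>2 * Z 1 s" for s
    define p'' where "p'' s = Z 4 s - \<i> * of_real \<omega> * Z 3 s + 2 * (of_real \<omega>)\<^sup>2 * Z 2 s" for s
    have Z': "(Z 0 has_vector_derivative Z 1 s) (at s)" "(Z 1 has_vector_derivative Z 2 s) (at s)"
        "(Z 2 has_vector_derivative Z 3 s) (at s)" "(Z 3 has_vector_derivative Z 4 s) (at s)" for s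
      using Z(1) [of 0 s] Z(1) [of 1 s] Z(1) [of 2 s] Z(1) [of 3 s]
      by (simp_all add: eval_nat_numeral)
    show "(p has_vector_derivative p' s) (at s)" for s
      unfolding p_def y_def p'_def by (rule derivative_eq_intros Z' refl)+ simp
    show "(p' has_vector_derivative p'' s) (at s)" for s
      unfolding p'_def p''_def by (rule derivative_eq_intros Z' refl)+ simp
    show "p L = p 0" "p' L = p' 0"
      by (simp_all add: p_def y_def p'_def Z(2))
    show "continuous_on {0..L} p''"
      unfolding p''_def by (intro continuous_intros)
  qed
  then have "(\<lambda>k. complex_of_real (u k)) sums pairing L p y"
    by (simp only: product u_def)
  from sums_Re [OF this] have sums: "u sums Re (pairing L p y)"
    by simp
  then show "0 \<le> Re (pairing L p y)"
    using u_nonneg sums_le [OF _ sums_zero] by blast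
  show "fourier L (Z 0) n = 0" if "Re (pairing L p y) = 0" "n \<notin> {-1, 0, 1, 2}"
  proof -
    have "u (int_encode n) = 0"
      using sums that(1) u_nonneg suminf_eq_zero_iff [of u] by (auto simp: sums_iff)
    moreover have "q n \<noteq> 0"
      using spectral_gap(2) [of n] that(2) by (auto simp: q_def)
    ultimately show ?thesis
      using \<omega> by (simp add: u_def c_def)
  qed
qed


section \<open>Closed plane curves as complex functions\<close>

lemma smooth_curve_has_vector_derivative:
  assumes "smooth_curve f"
  shows "((vderiv ^^ k) f has_vector_derivative (vderiv ^^ Suc k) f s) (at s)"
  using assms by (simp add: smooth_curve_def vderiv_def flip: vector_derivative_works)

lemma vderiv_periodic:
  assumes "\<And>s. g differentiable (at s)" "\<And>s. g (s + L) = g s"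
  shows "vderiv g (s + L) = vderiv g s"
proof -
  have "((\<lambda>t. t + L) has_vector_derivative 1) (at s)"
    by (auto intro!: derivative_eq_intros)
  moreover have "(g has_vector_derivative vderiv g (s + L)) (at (s + L))"
    using assms(1) by (simp add: vderiv_def flip: vector_derivative_works)
  ultimately have "((g \<circ> (\<lambda>t. t + L)) has_vector_derivative 1 *\<^sub>R vderiv g (s + L)) (at s)"
    by (rule vector_diff_chain_at)
  moreover have "g \<circ> (\<lambda>t. t + L) = g"
    using assms(2) by (simp add: fun_eq_iff)
  ultimately show ?thesis
    by (simp add: vderiv_def vector_derivative_at)
qed

lemma periodic_int_shift:
  fixes g :: "real \<Rightarrow> 'a"
  assumes "\<And>s. g (s + L) = g s"
  shows "g (s + of_int k * L) = g s"
proof (induction k arbitrary: s rule: int_induct [of _ 0])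
  case (step1 k)
  then show ?case
    using assms [of "s + of_int k * L"] by (simp add: algebra_simps)
next
  case (step2 k)
  then show ?case
    using assms [of "s + of_int (k - 1) * L"] by (simp add: algebra_simps)
qed simp

definition plane_to_complex :: "real ^ 2 \<Rightarrow> complex" where
  "plane_to_complex v = Complex (v $ 1) (v $ 2)"

lemma bounded_linear_plane_to_complex: "bounded_linear plane_to_complex"
proof -
  have "plane_to_complex = (\<lambda>v. of_real (v $ 1) + \<i> * of_real (v $ 2))"
    by (simp add: plane_to_complex_def complex_eq_iff fun_eq_iff)
  moreover have "bounded_linear (\<lambda>v :: real ^ 2. complex_of_real (v $ 1) + \<i> * of_real (v $ 2))"
    by (auto intro!: bounded_linear_add bounded_linear_const_mult
        bounded_linear_compose [OF bounded_linear_of_real] bounded_linear_vec_nth)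
  ultimately show ?thesis by simp
qed

lemma norm_plane_to_complex: "cmod (plane_to_complex v) = norm v"
  by (simp add: plane_to_complex_def cmod_def norm_vec_def L2_set_def sum_2)

text \<open>Differentiating \<open>norm (vderiv f s) = 1\<close> shows that the acceleration is orthogonal to the
  velocity, so it is a multiple of the unit normal, which is the velocity times \<open>\<i>\<close>.\<close>

lemma curvature_complex:
  assumes "smooth_curve f" "\<And>s. norm (vderiv f s) = 1"
  shows "plane_to_complex (vderiv (vderiv f) s)
    = \<i> * of_real (curvature f s) * plane_to_complex (vderiv f s)"
proof -
  define v a where "v = vderiv f" and "a = vderiv (vderiv f) s"
  have "(v has_vector_derivative a) (at s)"
    using smooth_curve_has_vector_derivative [OF assms(1), of 1 s] by (simp add: v_def a_def)
  then have "((\<lambda>t. v t \<bullet> v t) has_derivative (\<lambda>h. v s \<bullet> (h *\<^sub>R a) + (h *\<^sub>R a) \<bullet> v s)) (at s)"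
    unfolding has_vector_derivative_def by (intro has_derivative_inner)
  moreover have "v t \<bullet> v t = 1" for t
    using assms(2) [of t] by (simp add: v_def dot_square_norm)
  ultimately have "(\<lambda>h. v s \<bullet> (h *\<^sub>R a) + (h *\<^sub>R a) \<bullet> v s) = (\<lambda>h. 0)"
    using has_derivative_unique [OF _ has_derivative_const [of 1]] by simp
  from fun_cong [OF this, of 1] have "v s \<bullet> a = 0"
    by (simp add: inner_commute)
  then have orth: "v s $ 1 * a $ 1 + v s $ 2 * a $ 2 = 0"
    by (simp add: inner_vec_def sum_2)
  have unit: "(v s $ 1)\<^sup>2 + (v s $ 2)\<^sup>2 = 1"
    using assms(2) [of s] by (simp add: v_def norm_vec_def L2_set_def sum_2)
  have \<kappa>: "curvature f s = a $ 2 * v s $ 1 - a $ 1 * v s $ 2"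
    by (simp add: curvature_def curvature_vector_def unit_normal_def inner_vec_def sum_2
        v_def a_def)
  have "a $ 1 = a $ 1 * ((v s $ 1)\<^sup>2 + (v s $ 2)\<^sup>2) - v s $ 1 * (v s $ 1 * a $ 1 + v s $ 2 * a $ 2)"
      "a $ 2 = a $ 2 * ((v s $ 1)\<^sup>2 + (v s $ 2)\<^sup>2) - v s $ 2 * (v s $ 1 * a $ 1 + v s $ 2 * a $ 2)"
    unfolding orth unit by simp_all
  then have "a $ 1 = - curvature f s * v s $ 2" "a $ 2 = curvature f s * v s $ 1"
    unfolding \<kappa> by (simp_all add: algebra_simps power2_eq_square)
  then show ?thesis
    by (simp add: plane_to_complex_def complex_eq_iff v_def a_def)
qed

section \<open>The isoperimetric deficit and the deviation of curvature\<close>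

theorem theorem2p1:
  fixes L :: real and f :: "real \<Rightarrow> real ^ 2"
  assumes "arclength_closed_curve L f"
    and "rotation_number L f = 1"
  shows "I_minus_one L f \<le> I_zero L f / (8 * pi\<^sup>2) \<and>
         (I_minus_one L f = I_zero L f / (8 * pi\<^sup>2) \<longleftrightarrow> (\<forall>s. curvature_deviation L f s = 0))"
proof -
  have L: "L > 0" and smooth: "smooth_curve f" and per: "\<And>s. f (s + L) = f s"
    and unit: "\<And>s. norm (vderiv f s) = 1"
    using assms(1) by (auto simp: arclength_closed_curve_def)
  define \<omega> where "\<omega> = 2 * pi / L"
  have \<omega>: "\<omega> > 0"
    using L by (simp add: \<omega>_def)
  define Z where "Z k s = plane_to_complex ((vderiv ^^ k) f s)" for k s
  define \<kappa> where "\<kappa> = curvature_deviation L f"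
  define y where "y = (\<lambda>s. Z 2 s - \<i> * of_real \<omega> * Z 1 s)"
  define p where "p = (\<lambda>s. y s + 2 * (of_real \<omega>)\<^sup>2 * Z 0 s)"
  have periodic: "(vderiv ^^ k) f (s + L) = (vderiv ^^ k) f s" for k s
  proof (induction k arbitrary: s)
    case (Suc k)
    then show ?case
      using smooth by (simp add: vderiv_periodic smooth_curve_def)
  qed (simp add: per)
  have Z: "(Z k has_vector_derivative Z (Suc k) s) (at s)" "Z k L = Z k 0" for k s
    using bounded_linear.has_vector_derivative [OF bounded_linear_plane_to_complex
        smooth_curve_has_vector_derivative [OF smooth]] periodic [of k 0]
    by (simp_all add: Z_def [abs_def])
  have cont [continuous_intros]: "continuous_on {0..L} (Z k)" for k
    by (meson continuous_at_imp_continuous_on has_vector_derivative_continuous Z(1))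
  have y_cont [continuous_intros]: "continuous_on {0..L} y"
    unfolding y_def by (intro continuous_intros)
  have norm_Z1: "cmod (Z 1 s) = 1" for s
    using unit by (simp add: Z_def norm_plane_to_complex)

  have total: "integral {0..L} (curvature f) = 2 * pi"
    using assms(2) by (simp add: rotation_number_def)
  have \<kappa>_eq: "\<kappa> s = curvature f s - \<omega>" for s
    by (simp add: \<kappa>_def curvature_deviation_def total \<omega>_def)
  have y_eq: "y s = \<i> * of_real (\<kappa> s) * Z 1 s" for s
    using curvature_complex [OF smooth unit, of s]
    by (simp add: y_def Z_def \<kappa>_eq numeral_2_eq_2 algebra_simps)
  \<comment> \<open>Solving for the deviation shows that it is continuous.\<close>
  have \<kappa>_y: "of_real (\<kappa> s) = - \<i> * y s * cnj (Z 1 s)" for s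
    using norm_Z1 [of s] by (simp add: y_eq mult.assoc flip: complex_norm_square)
  have \<kappa>_cont: "continuous_on {0..L} \<kappa>"
  proof -
    have "continuous_on {0..L} (\<lambda>s. Re (- \<i> * y s * cnj (Z 1 s)))"
      by (intro continuous_intros)
    then show ?thesis
      unfolding \<kappa>_y [symmetric] by simp
  qed
  have \<kappa>_mean: "integral {0..L} \<kappa> = 0"
  proof -
    have "curvature f = (\<lambda>s. \<kappa> s + \<omega>)"
      by (simp add: \<kappa>_eq)
    then have "integral {0..L} (curvature f) = integral {0..L} \<kappa> + L * \<omega>"
      using L by (simp add: integral_add integrable_continuous_real \<kappa>_cont)
    then show ?thesis
      using L by (simp add: total \<omega>_def)
  qed

  have I0: "I_zero L f = L\<^sup>2 * Re (pairing L y y)"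
  proof -
    have "Re (y s * cnj (y s)) = (\<kappa> s)\<^sup>2" for s
    proof -
      have "Re (y s * cnj (y s)) = (cmod (y s))\<^sup>2"
        by (simp add: cmod_power2 flip: power2_eq_square)
      also have "cmod (y s) = \<bar>\<kappa> s\<bar>"
        using norm_Z1 [of s] by (simp add: y_eq norm_mult)
      finally show ?thesis by simp
    qed
    then show ?thesis
      using L by (simp add: I_zero_def Re_Im_pairing y_cont \<kappa>_def power2_eq_square del: times_complex.sel)
  qed
  have I1: "I_minus_one L f = - Re (pairing L (Z 0) y)"
  proof -
    have eq: "pairing L y (Z 0) = pairing L (Z 2) (Z 0) + (- \<i> * of_real \<omega>) * pairing L (Z 1) (Z 0)"
    proof -
      have "y = (\<lambda>s. Z 2 s + (- \<i> * of_real \<omega>) * Z 1 s)"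
        by (simp add: y_def fun_eq_iff)
      then show ?thesis
        by (simp only: pairing_scale_left pairing_add_left cont continuous_on_mult continuous_on_const)
    qed
    have Z': "(Z 1 has_vector_derivative Z 2 s) (at s)" "(Z 0 has_vector_derivative Z 1 s) (at s)" for s
      using Z(1) [of 1 s] Z(1) [of 0 s] by (simp_all add: numeral_2_eq_2)
    have "pairing L (Z 2) (Z 0) = - pairing L (Z 1) (Z 1)"
      by (rule pairing_by_parts [OF L Z'(1) cont Z(2) Z'(2) cont Z(2)])
    also have "pairing L (Z 1) (Z 1) = 1"
      using L norm_Z1
      by (simp add: pairing_def scaleR_conv_of_real flip: complex_norm_square)
    finally have "Re (pairing L y (Z 0)) = - 1 + \<omega> * Im (pairing L (Z 1) (Z 0))"
      unfolding eq by simp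
    also have "Im (pairing L (Z 1) (Z 0)) = integral {0..L} (\<lambda>s. - (f s \<bullet> unit_normal f s)) / L"
      unfolding Re_Im_pairing(2) [OF cont cont]
      by (simp add: Z_def plane_to_complex_def unit_normal_def inner_vec_def sum_2 algebra_simps)
    also have "- 1 + \<omega> * \<dots> = - I_minus_one L f"
      by (simp add: I_minus_one_def signed_area_def \<omega>_def power2_eq_square)
    finally show ?thesis
      by (simp flip: cnj_pairing [of L y "Z 0"])
  qed
  have defect: "Re (pairing L p y) = 2 * \<omega>\<^sup>2 * (I_zero L f / (8 * pi\<^sup>2) - I_minus_one L f)"
  proof -
    have "pairing L p y = pairing L y y + 2 * (of_real \<omega>)\<^sup>2 * pairing L (Z 0) y"
      unfolding p_def
      by (simp only: pairing_scale_left pairing_add_left cont y_cont continuous_on_mult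
          continuous_on_const)
    then have "Re (pairing L p y) = Re (pairing L y y) + 2 * \<omega>\<^sup>2 * Re (pairing L (Z 0) y)"
      by (simp add: power2_eq_square)
    moreover have "2 * \<omega>\<^sup>2 * (I_zero L f / (8 * pi\<^sup>2)) = Re (pairing L y y)"
      using L by (simp add: I0 \<omega>_def power_divide power_mult_distrib)
    ultimately show ?thesis
      unfolding I1 right_diff_distrib by simp
  qed
  have gap: "0 \<le> Re (pairing L p y)"
      "Re (pairing L p y) = 0 \<Longrightarrow> n \<notin> {-1, 0, 1, 2} \<Longrightarrow> fourier L (Z 0) n = 0" for n
    unfolding p_def y_def \<omega>_def
    using defect_nonneg [where L = L and Z = Z, OF L] Z by blast+

  show ?thesis
  proof (intro conjI iffI allI)
    show "I_minus_one L f \<le> I_zero L f / (8 * pi\<^sup>2)"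
      using gap(1) \<omega> by (simp add: defect zero_le_mult_iff)
  next
    assume "\<forall>s. curvature_deviation L f s = 0"
    then have "y = (\<lambda>s. 0)"
      by (simp add: y_eq \<kappa>_def fun_eq_iff)
    then show "I_minus_one L f = I_zero L f / (8 * pi\<^sup>2)"
      by (simp add: I0 I1 pairing_def)
  next
    fix s
    assume "I_minus_one L f = I_zero L f / (8 * pi\<^sup>2)"
    then have Z0: "fourier L (Z 0) n = 0" if "n \<notin> {-1, 0, 1, 2}" for n
      using gap(2) that by (simp add: defect)
    have step: "fourier L (Z (Suc k)) n = \<i> * of_real (\<omega> * of_int n) * fourier L (Z k) n" for k n
      unfolding \<omega>_def by (rule fourier_deriv [OF L Z(1) cont Z(2)])
    have "fourier L (Z 1) n = 0" if "n \<notin> {-1, 1, 2}" for n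
      using step [of 0 n] Z0 [of n] that by auto
    then obtain m where m: "\<And>n. n \<noteq> m \<Longrightarrow> fourier L (Z 1) n = 0"
      using unimodular_single_mode [OF L cont Z(2), of 1] norm_Z1 by blast
    \<comment> \<open>With a single mode \<open>m\<close>, differentiating \<open>Z 1\<close> multiplies it by \<open>\<i> * \<omega> * m\<close>, so \<open>y\<close> should
      be \<open>\<i> * \<omega> * (m - 1)\<close> times \<open>Z 1\<close>; the difference \<open>d\<close> has no Fourier coefficients.\<close>
    define d where "d s = y s + (- \<i> * of_real (\<omega> * of_int (m - 1))) * Z 1 s" for s
    have d_0: "d s = 0" if "s \<in> {0..L}" for s
    proof (rule fourier_eq_0_imp_0 [OF L _ _ _ that])
      show "continuous_on {0..L} d"
        unfolding d_def by (intro continuous_intros)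
      show "d L = d 0"
        by (simp add: d_def y_def Z(2))
      show "fourier L d n = 0" for n
      proof -
        have "d = (\<lambda>s. Z 2 s + (- \<i> * of_real (\<omega> * of_int m)) * Z 1 s)"
          by (simp add: d_def y_def fun_eq_iff algebra_simps)
        then have "fourier L d n
            = fourier L (Z 2) n + (- \<i> * of_real (\<omega> * of_int m)) * fourier L (Z 1) n"
          by (simp only: fourier_scale fourier_add cont continuous_on_mult continuous_on_const)
        also have "fourier L (Z 2) n = \<i> * of_real (\<omega> * of_int n) * fourier L (Z 1) n"
          using step [of 1 n] by (simp add: numeral_2_eq_2)
        finally show ?thesis
          using m [of n] by (cases "n = m") auto
      qed
    qed
    have const: "\<kappa> s = \<omega> * of_int (m - 1)" if "s \<in> {0..L}" for s
    proof -
      have "\<i> * of_real (\<kappa> s - \<omega> * of_int (m - 1)) * Z 1 s = 0"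
        using d_0 [OF that] by (simp add: d_def y_eq algebra_simps)
      moreover have "Z 1 s \<noteq> 0"
        using norm_Z1 [of s] by (metis norm_zero zero_neq_one)
      ultimately show ?thesis
        by (simp only: mult_eq_0_iff of_real_eq_0_iff) simp
    qed
    have "integral {0..L} \<kappa> = integral {0..L} (\<lambda>s. \<omega> * of_int (m - 1))"
      by (rule integral_cong) (rule const)
    then have "\<omega> * of_int (m - 1) = 0"
      using \<kappa>_mean L by simp
    then have zero: "\<kappa> s = 0" if "s \<in> {0..L}" for s
      using const [OF that] by simp
    \<comment> \<open>Periodicity carries the conclusion from one period to the whole line.\<close>
    have "curvature f (s + L) = curvature f s" for s
      using periodic [of 1 s] periodic [of 2 s]
      by (simp add: curvature_def curvature_vector_def unit_normal_def numeral_2_eq_2)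
    then have "\<kappa> (s + of_int (- \<lfloor>s / L\<rfloor>) * L) = \<kappa> s"
      by (intro periodic_int_shift) (simp add: \<kappa>_eq)
    moreover have "s + of_int (- \<lfloor>s / L\<rfloor>) * L \<in> {0..L}"
      using L floor_divide_lower [of L s] floor_divide_upper [of L s] by (simp add: algebra_simps)
    ultimately show "curvature_deviation L f s = 0"
      using zero by (simp flip: \<kappa>_def)
  qed
qed

end
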